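(* Let $X$ be a topological space satisfying ${\sf S}_1(\Omega_X,\Omega_X)$ and let $A\in\Omega_X$ be countable with a fixed bijective enumeration. Then every subset of $[A]^{\aleph_0}\cap\Omega_X$ that is open in the Ellentuck topology on $[A]^{\aleph_0}\cap\Omega_X$ is completely Ramsey.
   Context: An $\omega$-cover of $X$ is an open cover $\mathcal{U}$ with $X\notin\mathcal{U}$ such that each finite subset of $X$ lies in some member of $\mathcal{U}$; $\Omega_X$ is the set of $\omega$-covers. ${\sf S}_1(\Omega_X,\Omega_X)$: for every sequence of $\omega$-covers $(\mathcal{U}_n)$ there are $U_n\in\mathcal{U}_n$ with $\{U_n:n\in\mathbb{N}\}$ an $\omega$-cover. $[S]^{\aleph_0}$ denotes the countably infinite subsets of $S$. With the enumeration $A=\{a_n:n\in\mathbb{N}\}$: for $s,T\subseteq A$, $s<T$ means $a_n\in s$, $a_m\in T$ imply $n<m$; $B|s=\{a_n\in B:s<\{a_n\}\}$; for finite $s$ and infinite $C$ with $s<C$, $[s,C]=\{s\cup D: D\in[A]^{\aleph_0},D\subseteq C\}$. The sets $[s,C]$ form a base of the Ellentuck topology on $[A]^{\aleph_0}$, and $[A]^{\aleph_0}\cap\Omega_X$ carries the subspace topology. A set $R\subseteq[A]^{\aleph_0}\cap\Omega_X$ is completely Ramsey if for every finite $s\subseteq A$ and every $B\in[A|s]^{\aleph_0}\cap\Omega_X$ there is $C\in[B]^{\aleph_0}\cap\Omega_X$ with either $[s,C]\cap\Omega_X\subseteq R$ or $[s,C]\cap\Omega_X\cap R=\emptyset$.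 *)

theory Defs
  imports "HOL-Analysis.Analysis"
begin

definition omega_covers :: "'a topology \<Rightarrow> 'a set set set" where
  "omega_covers X =
    {\<U>. (\<forall>U\<in>\<U>. openin X U) \<and> \<Union>\<U> = topspace X \<and> topspace X \<notin> \<U> \<and>
         (\<forall>F. finite F \<and> F \<subseteq> topspace X \<longrightarrow> (\<exists>U\<in>\<U>. F \<subseteq> U))}"

definition S1 :: "'b set set \<Rightarrow> 'b set set \<Rightarrow> bool" where
  "S1 \<A> \<B> \<longleftrightarrow>
    (\<forall>\<U> :: nat \<Rightarrow> 'b set. (\<forall>n. \<U> n \<in> \<A>) \<longrightarrow>
       (\<exists>U. (\<forall>n. U n \<in> \<U> n) \<and> range U \<in> \<B>))"

definition ctbl_inf_subsets :: "'b set \<Rightarrow> 'b set set" where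
  "ctbl_inf_subsets S = {T. T \<subseteq> S \<and> countable T \<and> infinite T}"

text \<open>In the following, \<open>a\<close> is the enumeration of \<open>A\<close>.\<close>

definition set_before :: "(nat \<Rightarrow> 'b) \<Rightarrow> 'b set \<Rightarrow> 'b set \<Rightarrow> bool" where
  "set_before a s T \<longleftrightarrow> (\<forall>n m. a n \<in> s \<and> a m \<in> T \<longrightarrow> n < m)"

text \<open>\<open>tail_after a B s\<close> is $B|s$.\<close>

definition tail_after :: "(nat \<Rightarrow> 'b) \<Rightarrow> 'b set \<Rightarrow> 'b set \<Rightarrow> 'b set" where
  "tail_after a B s = {a n | n. a n \<in> B \<and> set_before a s {a n}}"

text \<open>\<open>ellentuck_set A s C\<close> is $[s,C]$; it is only used for finite \<open>s\<close> and infinite \<open>C\<close>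
  with \<open>set_before a s C\<close>.\<close>

definition ellentuck_set :: "'b set \<Rightarrow> 'b set \<Rightarrow> 'b set \<Rightarrow> 'b set set" where
  "ellentuck_set A s C = {s \<union> D | D. D \<in> ctbl_inf_subsets A \<and> D \<subseteq> C}"

definition ellentuck_base :: "'b set \<Rightarrow> (nat \<Rightarrow> 'b) \<Rightarrow> 'b set set set" where
  "ellentuck_base A a =
    {ellentuck_set A s C | s C.
       finite s \<and> s \<subseteq> A \<and> C \<in> ctbl_inf_subsets A \<and> set_before a s C}"

definition ellentuck_topology :: "'b set \<Rightarrow> (nat \<Rightarrow> 'b) \<Rightarrow> 'b set topology" where
  "ellentuck_topology A a = topology_generated_by (ellentuck_base A a)"

definition completely_ramsey ::
    "'a topology \<Rightarrow> 'a set set \<Rightarrow> (nat \<Rightarrow> 'a set) \<Rightarrow> 'a set set set \<Rightarrow> bool" where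
  "completely_ramsey X A a R \<longleftrightarrow>
    R \<subseteq> ctbl_inf_subsets A \<inter> omega_covers X \<and>
    (\<forall>s B. finite s \<and> s \<subseteq> A \<and> B \<in> ctbl_inf_subsets (tail_after a A s) \<inter> omega_covers X \<longrightarrow>
       (\<exists>C \<in> ctbl_inf_subsets B \<inter> omega_covers X.
          ellentuck_set A s C \<inter> omega_covers X \<subseteq> R \<or>
          ellentuck_set A s C \<inter> omega_covers X \<inter> R = {}))"

text \<open>\<open>topology_generated_by\<close> takes a subbase. The next lemmas confirm that the sets $[s,C]$
  are in fact a base of \<open>ellentuck_topology A a\<close>, whose underlying set is $[A]^{\aleph_0}$.\<close>

lemma ellentuck_base_Int:
  assumes a: "bij_betw a UNIV A"
    and S: "S \<in> ellentuck_base A a" and T: "T \<in> ellentuck_base A a"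
    and E: "E \<in> S" "E \<in> T"
  shows "\<exists>W \<in> ellentuck_base A a. E \<in> W \<and> W \<subseteq> S \<inter> T"
proof -
  have nest: "\<exists>W \<in> ellentuck_base A a. E \<in> W \<and> W \<subseteq> ellentuck_set A s C \<inter> ellentuck_set A t D"
    if s: "finite s" "s \<subseteq> A" "C \<in> ctbl_inf_subsets A" "set_before a s C"
      and t: "finite t" "t \<subseteq> A" "D \<in> ctbl_inf_subsets A" "set_before a t D"
      and ES: "E \<in> ellentuck_set A s C" and ET: "E \<in> ellentuck_set A t D" and st: "s \<subseteq> t"
    for s C t D
  proof -
    obtain C' where C': "E = s \<union> C'" "C' \<in> ctbl_inf_subsets A" "C' \<subseteq> C"
      using ES by (auto simp: ellentuck_set_def)
    obtain D' where D': "E = t \<union> D'" "D' \<in> ctbl_inf_subsets A" "D' \<subseteq> D"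
      using ET by (auto simp: ellentuck_set_def)
    have tD': "set_before a t D'"
      using t(4) D'(3) by (auto simp: set_before_def)
    have disj: "x \<notin> s" if "x \<in> D'" for x
    proof
      assume "x \<in> s"
      then have "x \<in> t" using st by auto
      moreover obtain n where "x = a n"
        using a \<open>x \<in> t\<close> t(2) by (auto simp: bij_betw_def)
      ultimately show False
        using that tD' unfolding set_before_def by blast
    qed
    have "ellentuck_set A t D' \<in> ellentuck_base A a"
      using t D' tD' by (auto simp: ellentuck_base_def)
    moreover have "E \<in> ellentuck_set A t D'"
      using D' by (auto simp: ellentuck_set_def)
    moreover have "ellentuck_set A t D' \<subseteq> ellentuck_set A t D"
      using D' by (auto simp: ellentuck_set_def)
    moreover have "ellentuck_set A t D' \<subseteq> ellentuck_set A s C"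
    proof
      fix F assume "F \<in> ellentuck_set A t D'"
      then obtain D'' where D'': "F = t \<union> D''" "D'' \<in> ctbl_inf_subsets A" "D'' \<subseteq> D'"
        by (auto simp: ellentuck_set_def)
      have "F = s \<union> ((t - s) \<union> D'')" using D'' st by auto
      moreover have "(t - s) \<union> D'' \<in> ctbl_inf_subsets A"
        using t D'' by (auto simp: ctbl_inf_subsets_def countable_finite)
      moreover have "(t - s) \<union> D'' \<subseteq> C"
      proof -
        have "t - s \<subseteq> C" using C' D' by blast
        moreover have "D'' \<subseteq> C" using C' D' D'' disj by blast
        ultimately show ?thesis by blast
      qed
      ultimately show "F \<in> ellentuck_set A s C"
        unfolding ellentuck_set_def by blast
    qed
    ultimately show ?thesis by blast
  qed
  obtain s C where S': "S = ellentuck_set A s C" "finite s" "s \<subseteq> A"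
      "C \<in> ctbl_inf_subsets A" "set_before a s C"
    using S by (auto simp: ellentuck_base_def)
  obtain t D where T': "T = ellentuck_set A t D" "finite t" "t \<subseteq> A"
      "D \<in> ctbl_inf_subsets A" "set_before a t D"
    using T by (auto simp: ellentuck_base_def)
  have "s \<subseteq> t \<or> t \<subseteq> s"
  proof (rule ccontr)
    assume "\<not> ?thesis"
    then obtain x y where xy: "x \<in> s" "x \<notin> t" "y \<in> t" "y \<notin> s" by blast
    obtain n m where nm: "x = a n" "y = a m"
      using bij_betw_imp_surj_on[OF a] xy S'(3) T'(3) by blast
    have "x \<in> D" "y \<in> C"
      using E xy S'(1) T'(1) by (auto simp: ellentuck_set_def)
    then have "m < n" "n < m"
      using xy nm S'(5) T'(5) unfolding set_before_def by blast+
    then show False by simp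
  qed
  then show ?thesis
    using nest[of s C t D] nest[of t D s C] S' T' E by (auto simp: Int_commute)
qed

lemma openin_ellentuck_topology:
  assumes a: "bij_betw a UNIV A"
  shows "openin (ellentuck_topology A a) U \<longleftrightarrow>
    (\<forall>E\<in>U. \<exists>W \<in> ellentuck_base A a. E \<in> W \<and> W \<subseteq> U)"
proof
  assume "openin (ellentuck_topology A a) U"
  then have "generate_topology_on (ellentuck_base A a) U"
    by (simp add: ellentuck_topology_def openin_topology_generated_by_iff)
  then show "\<forall>E\<in>U. \<exists>W \<in> ellentuck_base A a. E \<in> W \<and> W \<subseteq> U"
  proof induction
    case (Int S T)
    show ?case
    proof
      fix E assume "E \<in> S \<inter> T"
      then obtain V W where "V \<in> ellentuck_base A a" "E \<in> V" "V \<subseteq> S"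
        and "W \<in> ellentuck_base A a" "E \<in> W" "W \<subseteq> T"
        using Int by blast
      then show "\<exists>W \<in> ellentuck_base A a. E \<in> W \<and> W \<subseteq> S \<inter> T"
        using ellentuck_base_Int[OF a, of V W E] by blast
    qed
  next
    case (UN K)
    then show ?case by (meson Union_iff Union_upper subset_trans)
  qed auto
next
  assume *: "\<forall>E\<in>U. \<exists>W \<in> ellentuck_base A a. E \<in> W \<and> W \<subseteq> U"
  show "openin (ellentuck_topology A a) U"
  proof (subst openin_subopen, intro ballI)
    fix E assume "E \<in> U"
    then obtain W where "W \<in> ellentuck_base A a" "E \<in> W" "W \<subseteq> U" using * by blast
    then show "\<exists>T. openin (ellentuck_topology A a) T \<and> E \<in> T \<and> T \<subseteq> U"
      unfolding ellentuck_topology_def using topology_generated_by_Basis by blast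
  qed
qed

lemma topspace_ellentuck_topology:
  assumes a: "bij_betw a UNIV A"
  shows "topspace (ellentuck_topology A a) = ctbl_inf_subsets A"
proof
  show "topspace (ellentuck_topology A a) \<subseteq> ctbl_inf_subsets A"
    by (auto simp: ellentuck_topology_def ellentuck_base_def ellentuck_set_def
        ctbl_inf_subsets_def countable_finite)
next
  have "infinite A" "countable A"
    using a bij_betw_finite[OF a] by (auto simp: bij_betw_def)
  then have "ellentuck_set A {} A \<in> ellentuck_base A a"
    unfolding ellentuck_base_def
    by (force simp: ctbl_inf_subsets_def set_before_def)
  moreover have "ctbl_inf_subsets A \<subseteq> ellentuck_set A {} A"
    by (auto simp: ellentuck_set_def ctbl_inf_subsets_def)
  ultimately show "ctbl_inf_subsets A \<subseteq> topspace (ellentuck_topology A a)"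
    by (auto simp: ellentuck_topology_def)
qed

end

theory Submission
  imports Defs
begin

text \<open>Identify subsets of \<open>A\<close> with sets of indices. The index sets of \<open>\<omega>\<close>-covers form a coideal.
  It is selective: given a decreasing sequence of \<open>\<omega>\<close>-covers \<open>C\<^sub>n\<close>, one use of \<open>S\<^sub>1\<close> yields an
  \<open>\<omega>\<close>-cover almost contained in every \<open>C\<^sub>n\<close>; a second use, applied to the covers by intersections
  of \<open>n + 1\<close> members whose indices are very far apart, thins it out to a sparse \<open>\<omega>\<close>-cover, because
  from the \<open>n\<close>-th intersection one can pick a member far from the \<open>n\<close> members picked before.
  For a selective coideal, the accept/reject argument of Galvin, Prikry and Ellentuck shows that
  open sets are Ramsey. A neighbourhood \<open>[s,C]\<close> of an \<open>\<omega>\<close>-cover \<open>E\<close> may be shrunk to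
  \<open>[s,E|s]\<close>, so it does not matter that \<open>C\<close> ranges over all infinite sets.\<close>

section \<open>Selective coideals on the natural numbers\<close>

text \<open>The complement of \<open>H\<close> is an ideal containing all finite sets.
  \<open>diagonal\<close> is selectivity in Mathias's form: the elements of \<open>D\<close>
  themselves index the sets \<open>C i\<close>, so no finite errors remain.\<close>

locale selective_coideal =
  fixes H :: "nat set set"
  assumes infinite_mem: "N \<in> H \<Longrightarrow> infinite N"
    and mem_mono: "N \<in> H \<Longrightarrow> N \<subseteq> M \<Longrightarrow> M \<in> H"
    and mem_Un: "N \<union> M \<in> H \<Longrightarrow> N \<in> H \<or> M \<in> H"
    and diagonal: "(\<And>n. C n \<in> H) \<Longrightarrow> decseq C \<Longrightarrow>
      \<exists>D\<in>H. D \<subseteq> C 0 \<and> (\<forall>i\<in>D. \<forall>j\<in>D. i < j \<longrightarrow> j \<in> C i)"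
begin

lemma mem_Diff: "N \<in> H \<Longrightarrow> M \<notin> H \<Longrightarrow> N - M \<in> H"
  using mem_Un[of "N - M" M] mem_mono[of N "N - M \<union> M"] by auto

lemma mem_Diff_finite: "N \<in> H \<Longrightarrow> finite F \<Longrightarrow> N - F \<in> H"
  using mem_Diff[of N F] infinite_mem[of F] by auto

lemma finite_Union_notin:
  assumes "finite K" "\<And>Z. Z \<in> K \<Longrightarrow> Z \<notin> H"
  shows "\<Union>K \<notin> H"
  using assms
proof (induction K)
  case empty
  then show ?case using infinite_mem[of "{}"] by auto
next
  case (insert Z K)
  then show ?case using mem_Un[of Z "\<Union>K"] by auto
qed

section \<open>Accepting and rejecting finite stems\<close>

definition accepts :: "nat set set \<Rightarrow> nat set \<Rightarrow> nat set \<Rightarrow> bool" where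
  "accepts R t N \<longleftrightarrow> (\<forall>D\<in>H. D \<subseteq> N \<and> (\<forall>x\<in>t. \<forall>y\<in>D. x < y) \<longrightarrow> t \<union> D \<in> R)"

definition rejects :: "nat set set \<Rightarrow> nat set \<Rightarrow> nat set \<Rightarrow> bool" where
  "rejects R t N \<longleftrightarrow> (\<forall>M\<in>H. M \<subseteq> N \<longrightarrow> \<not> accepts R t M)"

abbreviation decides :: "nat set set \<Rightarrow> nat set \<Rightarrow> nat set \<Rightarrow> bool" where
  "decides R t N \<equiv> accepts R t N \<or> rejects R t N"

text \<open>Only extensions beyond \<open>t\<close> are tested, so only the part of \<open>M\<close>
  beyond \<open>t\<close> has to lie in \<open>N\<close>. This weak inclusion is what a diagonal set
  satisfies.\<close>

lemma accepts_mono: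
  assumes "accepts R t N" "{y \<in> M. \<forall>x\<in>t. x < y} \<subseteq> N"
  shows "accepts R t M"
  unfolding accepts_def
proof (intro ballI impI)
  fix D assume D: "D \<in> H" "D \<subseteq> M \<and> (\<forall>x\<in>t. \<forall>y\<in>D. x < y)"
  then have "D \<subseteq> N" using assms(2) by auto
  then show "t \<union> D \<in> R" using D assms(1) by (simp add: accepts_def)
qed

lemma rejects_mono:
  assumes "rejects R t N" "{y \<in> M. \<forall>x\<in>t. x < y} \<subseteq> N" "finite t"
  shows "rejects R t M"
  unfolding rejects_def
proof (intro ballI impI notI)
  fix M' assume M': "M' \<in> H" "M' \<subseteq> M" "accepts R t M'"
  \<comment> \<open>Dropping the finitely many elements not beyond \<open>t\<close> keeps
    \<open>M'\<close> in the coideal and moves it inside \<open>N\<close>.\<close>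
  define L where "L = {y \<in> M'. \<forall>x\<in>t. x < y}"
  have "finite (M' - L)"
  proof (rule finite_subset)
    show "M' - L \<subseteq> (\<Union>x\<in>t. {..x})" by (auto simp: L_def not_less)
  qed (use assms(3) in auto)
  moreover have "L = M' - (M' - L)" by (auto simp: L_def)
  ultimately have "L \<in> H" using mem_Diff_finite[OF M'(1)] by metis
  moreover have "L \<subseteq> N" using M'(2) assms(2) by (auto simp: L_def)
  moreover have "accepts R t L" using accepts_mono[OF M'(3)] by (auto simp: L_def)
  ultimately show False using assms(1) by (auto simp: rejects_def)
qed

lemma decides_mono:
  assumes "decides R t N" "{y \<in> M. \<forall>x\<in>t. x < y} \<subseteq> N" "finite t"
  shows "decides R t M"
  using assms(1) accepts_mono[OF _ assms(2)] rejects_mono[OF _ assms(2,3)] by metis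

lemma decides_one:
  assumes "B \<in> H"
  obtains C where "C \<in> H" "C \<subseteq> B" "decides R t C"
proof (cases "rejects R t B")
  case True
  then show ?thesis using that assms by simp
next
  case False
  then show ?thesis using that unfolding rejects_def by metis
qed

lemma decides_finite:
  assumes "finite T" "\<forall>t\<in>T. finite t" "B \<in> H"
  shows "\<exists>C\<in>H. C \<subseteq> B \<and> (\<forall>t\<in>T. decides R t C)"
  using assms
proof (induction T)
  case (insert t T)
  then obtain C where C: "C \<in> H" "C \<subseteq> B" "\<forall>t\<in>T. decides R t C" by auto
  obtain D where D: "D \<in> H" "D \<subseteq> C" "decides R t D" by (rule decides_one[OF C(1)])
  have "decides R u D" if "u \<in> T" for u
    using decides_mono[of R u C D] C D that insert.prems by auto
  then show ?case using C D by (intro bexI[of _ D]) auto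
qed auto

text \<open>Fusion: \<open>C n\<close> decides every subset of \<open>{..n}\<close>, and beyond
  \<open>Max t\<close> the diagonal set lies in \<open>C (Max t)\<close>. Requiring only
  \<open>Max t \<in> D\<close> admits stems whose lower elements are outside
  \<open>D\<close>.\<close>

lemma decides_all:
  assumes "B \<in> H"
  shows "\<exists>D\<in>H. D \<subseteq> B \<and> (\<forall>t. finite t \<and> t \<noteq> {} \<and> Max t \<in> D \<longrightarrow> decides R t D)"
proof -
  define P where "P n C \<longleftrightarrow> C \<in> H \<and> C \<subseteq> B \<and> (\<forall>t\<subseteq>{..n}. decides R t C)" for n :: nat and C
  have step: "\<exists>C'. P n C' \<and> C' \<subseteq> C" if "C \<in> H" "C \<subseteq> B" for n C
  proof -
    have "finite (Pow {..n})" "\<forall>t\<in>Pow {..n}. finite t" by (auto intro: finite_subset)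
    from decides_finite[OF this that(1), of R] obtain C'
      where C': "C' \<in> H" "C' \<subseteq> C" "\<forall>t\<in>Pow {..n}. decides R t C'" by blast
    then have "P n C'" using that(2) by (auto simp: P_def)
    with C'(2) show ?thesis by blast
  qed
  have "\<exists>C. \<forall>n. P n (C n) \<and> C (Suc n) \<subseteq> C n"
  proof (rule dependent_nat_choice)
    show "\<exists>C. P 0 C" using step assms by blast
  next
    fix C n assume "P n C"
    then show "\<exists>C'. P (Suc n) C' \<and> C' \<subseteq> C" using step[of C "Suc n"] by (auto simp: P_def)
  qed
  then obtain C where C: "\<And>n. P n (C n)" "\<And>n. C (Suc n) \<subseteq> C n" by blast
  have "decseq C" using C(2) by (simp add: decseq_Suc_iff)
  moreover have "\<And>n. C n \<in> H" using C(1) by (auto simp: P_def)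
  ultimately obtain D where D: "D \<in> H" "D \<subseteq> C 0" "\<forall>i\<in>D. \<forall>j\<in>D. i < j \<longrightarrow> j \<in> C i"
    using diagonal[of C] by blast
  have "decides R t D" if t: "finite t" "t \<noteq> {}" "Max t \<in> D" for t
  proof (rule decides_mono)
    have "t \<subseteq> {..Max t}" using t(1) by auto
    then show "decides R t (C (Max t))" using C(1)[of "Max t"] by (simp add: P_def)
    show "{y \<in> D. \<forall>x\<in>t. x < y} \<subseteq> C (Max t)" using D(3) t(3) Max_in[OF t(1,2)] by blast
  qed (fact t)
  moreover have "D \<subseteq> B" using D(2) C(1)[of 0] by (auto simp: P_def)
  ultimately show ?thesis using D(1) by auto
qed

text \<open>Otherwise this set would accept \<open>t\<close>: split off the least element
  \<open>m\<close> of an extension \<open>D\<close> inside it and use that \<open>C\<close> accepts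
  \<open>insert m t\<close>. That contradicts \<open>rejects R t C\<close>.\<close>

lemma rejects_extend:
  assumes "rejects R t C" "C \<in> H" "finite t"
  shows "{m \<in> C. (\<forall>x\<in>t. x < m) \<and> accepts R (insert m t) C} \<notin> H" (is "?Z \<notin> H")
proof
  assume Z: "?Z \<in> H"
  have "accepts R t ?Z"
    unfolding accepts_def[of R t]
  proof (intro ballI impI)
    fix D assume D: "D \<in> H" "D \<subseteq> ?Z \<and> (\<forall>x\<in>t. \<forall>y\<in>D. x < y)"
    define m where "m = (LEAST m. m \<in> D)"
    have "D \<noteq> {}" using infinite_mem[OF D(1)] by auto
    then have m: "m \<in> D" "\<And>y. y \<in> D \<Longrightarrow> m \<le> y"
      unfolding m_def by (auto intro: LeastI Least_le)
    have "D - {m} \<in> H" using D(1) mem_Diff_finite by auto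
    moreover have "accepts R (insert m t) C" using m(1) D(2) by auto
    moreover have "D - {m} \<subseteq> C" using D(2) by auto
    moreover have "\<forall>x\<in>insert m t. \<forall>y\<in>D - {m}. x < y" using D(2) m(2) by (auto simp: le_less)
    ultimately have "insert m t \<union> (D - {m}) \<in> R" unfolding accepts_def by blast
    moreover have "insert m t \<union> (D - {m}) = t \<union> D" using m(1) by auto
    ultimately show "t \<union> D \<in> R" by simp
  qed
  moreover have "?Z \<subseteq> C" by auto
  ultimately show False using assms(1)[unfolded rejects_def, rule_format, OF Z] by simp
qed

text \<open>By \<open>rejects_extend\<close> the bad next elements \<open>Z u\<close> of a rejected
  stem are not in \<open>H\<close>, nor is a finite union of such sets. Diagonalize over the
  complements and add elements in increasing order: each new stem is not accepted, hence rejected,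
  being decided.\<close>

lemma rejects_all:
  assumes C: "C \<in> H" and s: "finite s" "\<forall>x\<in>s. \<forall>y\<in>C. x < y"
    and dec: "\<And>u. finite u \<Longrightarrow> u \<subseteq> C \<Longrightarrow> decides R (s \<union> u) C"
    and rej: "rejects R s C"
  shows "\<exists>D\<in>H. D \<subseteq> C \<and> (\<forall>u\<subseteq>D. finite u \<longrightarrow> rejects R (s \<union> u) C)"
proof -
  define Z where "Z u = {m \<in> C. (\<forall>x\<in>s \<union> u. x < m) \<and> accepts R (insert m (s \<union> u)) C}" for u
  define I where "I n = {u. u \<subseteq> {..n} \<and> rejects R (s \<union> u) C}" for n
  define K where "K n = C - \<Union>(Z ` I n)" for n :: nat
  have "K n \<in> H" for n
  proof -
    have "finite (I n)" by (rule finite_subset[of _ "Pow {..n}"]) (auto simp: I_def)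
    moreover have "Z u \<notin> H" if "u \<in> I n" for u
    proof -
      have "finite u" using that by (auto simp: I_def intro: finite_subset)
      then show ?thesis using rejects_extend[of R "s \<union> u" C] that C s by (auto simp: Z_def I_def)
    qed
    ultimately have "\<Union>(Z ` I n) \<notin> H" by (intro finite_Union_notin) auto
    then show ?thesis unfolding K_def using mem_Diff C by blast
  qed
  moreover have "decseq K"
  proof -
    have "I n \<subseteq> I m" if "n \<le> m" for n m using that by (force simp: I_def)
    then show ?thesis unfolding decseq_def K_def by blast
  qed
  ultimately obtain D where D: "D \<in> H" "D \<subseteq> K 0" "\<forall>i\<in>D. \<forall>j\<in>D. i < j \<longrightarrow> j \<in> K i"
    using diagonal[of K] by blast
  have DC: "D \<subseteq> C" using D(2) by (auto simp: K_def)
  have "rejects R (s \<union> u) C" if "finite u" "u \<subseteq> D" for u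
    using that
  proof (induction u rule: finite_linorder_max_induct)
    case empty
    then show ?case using rej by simp
  next
    case (insert m u)
    then have IH: "rejects R (s \<union> u) C" by auto
    have "m \<notin> Z u"
    \<comment> \<open>The empty \<open>u\<close> has no maximum; there
      \<open>D \<subseteq> K 0\<close> excludes the bad elements, as
      \<open>{} \<in> I 0\<close>.\<close>
    proof (cases "u = {}")
      case True
      then have "u \<in> I 0" using IH by (auto simp: I_def)
      then show ?thesis using D(2) insert.prems by (auto simp: K_def)
    next
      case False
      then have "u \<in> I (Max u)" using IH insert.hyps(1) by (auto simp: I_def)
      moreover have "Max u \<in> D" "Max u < m"
        using insert.hyps insert.prems Max_in[OF insert.hyps(1) False] by blast+
      then have "m \<in> K (Max u)" using D(3) insert.prems by auto
      ultimately show ?thesis by (auto simp: K_def)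
    qed
    moreover have "m \<in> C" using insert.prems DC by auto
    moreover have "\<forall>x\<in>s \<union> u. x < m" using insert.hyps s(2) \<open>m \<in> C\<close> by auto
    ultimately have "\<not> accepts R (insert m (s \<union> u)) C" by (simp add: Z_def)
    moreover have "decides R (s \<union> insert m u) C"
      by (rule dec) (use insert DC in auto)
    ultimately show ?case by simp
  qed
  then show ?thesis using D(1) DC by blast
qed

text \<open>The hypothesis on \<open>R\<close> says that \<open>R\<close> is open in the topology with basic sets
  \<open>[s,C]\<close> for \<open>C\<close> in the coideal.\<close>

theorem open_imp_ramsey:
  assumes opn: "\<And>E. E \<in> H \<Longrightarrow> E \<in> R \<Longrightarrow>
      \<exists>k. \<forall>E'\<in>H. E' \<subseteq> E \<and> E' \<inter> {..<k} = E \<inter> {..<k} \<longrightarrow> E' \<in> R"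
    and B: "B \<in> H" and s: "finite s" "\<forall>x\<in>s. \<forall>y\<in>B. x < y"
  shows "\<exists>C\<in>H. C \<subseteq> B \<and>
    ((\<forall>D\<in>H. D \<subseteq> C \<longrightarrow> s \<union> D \<in> R) \<or> (\<forall>D\<in>H. D \<subseteq> C \<longrightarrow> s \<union> D \<notin> R))"
proof -
  \<comment> \<open>\<open>decides_all\<close> reaches only nonempty stems with maximum in
    \<open>C\<close>, so \<open>s\<close> itself is decided beforehand.\<close>
  obtain B' where B': "B' \<in> H" "B' \<subseteq> B" "decides R s B'" by (rule decides_one[OF B])
  obtain C where C: "C \<in> H" "C \<subseteq> B'"
    and decC: "\<And>t. finite t \<Longrightarrow> t \<noteq> {} \<Longrightarrow> Max t \<in> C \<Longrightarrow> decides R t C"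
    using decides_all[OF B'(1), of R] by blast
  have sC: "\<forall>x\<in>s. \<forall>y\<in>C. x < y" using s C B' by blast
  have dec: "decides R (s \<union> u) C" if u: "finite u" "u \<subseteq> C" for u
  proof (cases "u = {}")
    case True
    then show ?thesis using decides_mono[OF B'(3), of C] C(2) s by auto
  next
    case False
    then have "Max u \<in> u" using u by simp
    then have "Max (s \<union> u) = Max u"
      using s(1) u sC by (intro Max_eqI) (auto simp: less_imp_le)
    moreover have "Max u \<in> C" using u \<open>Max u \<in> u\<close> by blast
    ultimately show ?thesis using decC[of "s \<union> u"] s u False by simp
  qed
  show ?thesis
  proof (cases "accepts R s C")
    case True
    then have "\<forall>D\<in>H. D \<subseteq> C \<longrightarrow> s \<union> D \<in> R" using sC unfolding accepts_def by blast
    then show ?thesis using C B' by blast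
  next
    case False
    then have "rejects R s C" using dec[of "{}"] by simp
    then obtain D where D: "D \<in> H" "D \<subseteq> C"
      and rejD: "\<And>u. finite u \<Longrightarrow> u \<subseteq> D \<Longrightarrow> rejects R (s \<union> u) C"
      using rejects_all[OF C(1) s(1) sC dec] by blast
    \<comment> \<open>If \<open>s \<union> E\<close> were in \<open>R\<close>, openness would make
      the tail \<open>N\<close> of \<open>E\<close> accept the finite stem
      \<open>s \<union> u\<close>, although \<open>C\<close> rejects it.\<close>
    have "s \<union> E \<notin> R" if E: "E \<in> H" "E \<subseteq> D" for E
    proof
      assume "s \<union> E \<in> R"
      moreover have "s \<union> E \<in> H" using E mem_mono by blast
      ultimately obtain k where
        k: "\<forall>E'\<in>H. E' \<subseteq> s \<union> E \<and> E' \<inter> {..<k} = (s \<union> E) \<inter> {..<k} \<longrightarrow> E' \<in> R"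
        using opn[of "s \<union> E"] by metis
      define u where "u = E \<inter> {..<k}"
      define N where "N = E - {..<k}"
      have "accepts R (s \<union> u) N"
        unfolding accepts_def
      proof (intro ballI impI)
        fix D' assume D': "D' \<in> H" "D' \<subseteq> N \<and> (\<forall>x\<in>s \<union> u. \<forall>y\<in>D'. x < y)"
        have "(s \<union> u \<union> D') \<inter> {..<k} = (s \<union> E) \<inter> {..<k}"
          using D'(2) by (auto simp: u_def N_def)
        moreover have "s \<union> u \<union> D' \<in> H" using D'(1) mem_mono by blast
        moreover have "s \<union> u \<union> D' \<subseteq> s \<union> E" using D'(2) by (auto simp: u_def N_def)
        ultimately show "s \<union> u \<union> D' \<in> R" using k by blast
      qed
      moreover have "N \<in> H" unfolding N_def using E(1) mem_Diff_finite by blast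
      moreover have "N \<subseteq> C" using E D by (auto simp: N_def)
      ultimately have "\<not> rejects R (s \<union> u) C" unfolding rejects_def by blast
      moreover have "rejects R (s \<union> u) C" by (rule rejD) (use E in \<open>auto simp: u_def\<close>)
      ultimately show False by simp
    qed
    then show ?thesis using D C B' by blast
  qed
qed

end

section \<open>The coideal of \<open>\<omega>\<close>-covers\<close>

lemma omega_covers_proper:
  assumes "\<U> \<in> omega_covers X" "U \<in> \<U>"
  shows "U \<subset> topspace X"
proof -
  have "openin X U" "U \<noteq> topspace X" using assms by (auto simp: omega_covers_def)
  then show ?thesis using openin_subset by fastforce
qed

lemma omega_coversI:
  assumes "\<And>U. U \<in> \<U> \<Longrightarrow> openin X U" "\<And>U. U \<in> \<U> \<Longrightarrow> U \<noteq> topspace X"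
    and "\<And>F. finite F \<Longrightarrow> F \<subseteq> topspace X \<Longrightarrow> \<exists>U\<in>\<U>. F \<subseteq> U"
  shows "\<U> \<in> omega_covers X"
proof -
  have "x \<in> \<Union>\<U>" if "x \<in> topspace X" for x using assms(3)[of "{x}"] that by auto
  moreover have "\<Union>\<U> \<subseteq> topspace X" using assms(1) openin_subset by blast
  ultimately have "\<Union>\<U> = topspace X" by auto
  then show ?thesis using assms unfolding omega_covers_def by auto
qed

text \<open>Subfamilies inherit openness and properness of their members, and covering follows from
  singletons, so only the finite-set condition remains.\<close>

lemma omega_covers_subset_iff:
  assumes "\<U> \<in> omega_covers X" "\<V> \<subseteq> \<U>"
  shows "\<V> \<in> omega_covers X \<longleftrightarrow>
    (\<forall>F. finite F \<and> F \<subseteq> topspace X \<longrightarrow> (\<exists>U\<in>\<V>. F \<subseteq> U))"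
proof
  assume "\<forall>F. finite F \<and> F \<subseteq> topspace X \<longrightarrow> (\<exists>U\<in>\<V>. F \<subseteq> U)"
  with assms show "\<V> \<in> omega_covers X"
    by (intro omega_coversI) (auto simp: omega_covers_def)
qed (auto simp: omega_covers_def)

lemma omega_covers_mono:
  assumes "\<U> \<in> omega_covers X" "\<W> \<in> omega_covers X" "\<W> \<subseteq> \<V>" "\<V> \<subseteq> \<U>"
  shows "\<V> \<in> omega_covers X"
  unfolding omega_covers_subset_iff[OF assms(1,4)]
proof (intro allI impI)
  fix F assume "finite F \<and> F \<subseteq> topspace X"
  then have "\<exists>U\<in>\<W>. F \<subseteq> U" using assms(2) by (simp add: omega_covers_def)
  then show "\<exists>U\<in>\<V>. F \<subseteq> U" using assms(3) by (meson subsetD)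
qed

text \<open>Choose a point outside each member; for finitely many members these points would form a
  finite set contained in none of them.\<close>

lemma omega_covers_infinite:
  assumes "\<U> \<in> omega_covers X"
  shows "infinite \<U>"
proof
  assume "finite \<U>"
  have "\<forall>U\<in>\<U>. \<exists>x. x \<in> topspace X - U" using omega_covers_proper[OF assms] by blast
  then obtain x where "\<forall>U\<in>\<U>. x U \<in> topspace X - U" by metis
  moreover from this \<open>finite \<U>\<close> obtain U where "U \<in> \<U>" "x ` \<U> \<subseteq> U"
    using assms unfolding omega_covers_def by (auto dest!: spec[of _ "x ` \<U>"])
  ultimately show False by blast
qed

text \<open>If \<open>F\<close> lies in no member of \<open>\<V>\<close> and \<open>G\<close> in no
  member of \<open>\<W>\<close>, then \<open>F \<union> G\<close> lies in no member of
  either.\<close>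

lemma omega_covers_Un:
  assumes "\<V> \<union> \<W> \<in> omega_covers X"
  shows "\<V> \<in> omega_covers X \<or> \<W> \<in> omega_covers X"
proof (rule ccontr)
  assume "\<not> ?thesis"
  then obtain F G where FG: "finite F" "F \<subseteq> topspace X" "\<not> (\<exists>U\<in>\<V>. F \<subseteq> U)"
    "finite G" "G \<subseteq> topspace X" "\<not> (\<exists>U\<in>\<W>. G \<subseteq> U)"
    using omega_covers_subset_iff[OF assms, of \<V>] omega_covers_subset_iff[OF assms, of \<W>] by blast
  then obtain U where "U \<in> \<V> \<union> \<W>" "F \<union> G \<subseteq> U"
    using omega_covers_subset_iff[OF assms subset_refl] assms by (metis finite_Un Un_least)
  with FG show False by auto
qed

text \<open>If only finitely many members contained \<open>F\<close>, \<open>omega_covers_Un\<close>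
  would allow discarding them, leaving an \<omega>-cover with no member above
  \<open>F\<close>.\<close>

lemma omega_covers_above_infinite:
  assumes "\<U> \<in> omega_covers X" "finite F" "F \<subseteq> topspace X"
  shows "infinite {U \<in> \<U>. F \<subseteq> U}"
proof
  assume fin: "finite {U \<in> \<U>. F \<subseteq> U}"
  define \<V> where "\<V> = {U \<in> \<U>. \<not> F \<subseteq> U}"
  have "{U \<in> \<U>. F \<subseteq> U} \<union> \<V> = \<U>" by (auto simp: \<V>_def)
  then have "\<V> \<in> omega_covers X"
    using omega_covers_Un[of "{U \<in> \<U>. F \<subseteq> U}" \<V> X] assms(1) omega_covers_infinite fin by auto
  then have "\<exists>U\<in>\<V>. F \<subseteq> U" using assms(2,3) by (simp add: omega_covers_def)
  then show False by (auto simp: \<V>_def)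
qed

lemma infinite_nat_sparse_subset:
  assumes "infinite (N :: nat set)"
  shows "\<exists>M\<subseteq>N. finite M \<and> card M = n \<and> (\<forall>i\<in>M. \<forall>j\<in>M. i < j \<longrightarrow> g i \<le> j)"
proof (induction n)
  case 0
  show ?case by (intro exI[of _ "{}"]) auto
next
  case (Suc n)
  then obtain M where M: "M \<subseteq> N" "finite M" "card M = n" "\<forall>i\<in>M. \<forall>j\<in>M. i < j \<longrightarrow> g i \<le> j"
    by blast
  \<comment> \<open>\<open>b\<close> bounds all chosen elements and their \<open>g\<close>-values,
    so any \<open>m\<close> above it can be added; the \<open>0\<close> keeps \<open>Max\<close>
    defined for empty \<open>M\<close>.\<close>
  define b where "b = Max (insert 0 (M \<union> g ` M))"
  have b: "x \<le> b" if "x \<in> M \<union> g ` M" for x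
    unfolding b_def using M(2) that by (intro Max_ge) auto
  obtain m where m: "m \<in> N" "b < m" using assms infinite_nat_iff_unbounded by blast
  have lt: "x < m" "g x < m" if "x \<in> M" for x
    using b[of x] b[of "g x"] that m by auto
  have "\<forall>i\<in>insert m M. \<forall>j\<in>insert m M. i < j \<longrightarrow> g i \<le> j"
    using M(4) lt by (auto simp: less_imp_le dest: less_asym)
  moreover have "m \<notin> M" using lt by blast
  ultimately show ?case using M m(1) by (intro exI[of _ "insert m M"]) auto
qed

section \<open>Selectivity of \<omega>-covers from \<open>S1\<close>\<close>

context
  fixes X :: "'a topology" and A :: "'a set set" and a :: "nat \<Rightarrow> 'a set"
  assumes S1: "S1 (omega_covers X) (omega_covers X)"
    and A: "A \<in> omega_covers X" and a: "bij_betw a UNIV A"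
begin

lemma inj_enum: "inj a" and range_enum: "range a = A"
  using a by (auto simp: bij_betw_def)

lemma image_enum_subset: "a ` N \<subseteq> A"
  using range_enum by auto

text \<open>Two indices \<open>i\<close>, \<open>j\<close> conflict if \<open>i \<le> j < f i\<close> or \<open>j \<le> i < f j\<close>. Among indices separated
  by \<open>f \<circ> f\<close>, at most one conflicts with a given \<open>p\<close>.\<close>

lemma sparse_omega_cover:
  assumes N: "a ` N \<in> omega_covers X" and f: "mono f" "\<And>n. n < f n"
  shows "\<exists>D\<subseteq>N. a ` D \<in> omega_covers X \<and> (\<forall>i\<in>D. \<forall>j\<in>D. i < j \<longrightarrow> f i \<le> j)"
proof -
  \<comment> \<open>With \<open>Suc n\<close> indices one stays free, since each of the
    \<open>n\<close> earlier picks excludes at most one; the gap \<open>f (f i)\<close> ensures this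
    uniqueness.\<close>
  define \<M> where "\<M> n = {M. M \<subseteq> N \<and> finite M \<and> card M = Suc n \<and>
    (\<forall>i\<in>M. \<forall>j\<in>M. i < j \<longrightarrow> f (f i) \<le> j)}" for n
  define \<W> where "\<W> n = (\<lambda>M. \<Inter>(a ` M)) ` \<M> n" for n
  have "\<W> n \<in> omega_covers X" for n
  proof (rule omega_coversI)
    fix W assume "W \<in> \<W> n"
    then obtain M where M: "M \<in> \<M> n" "W = \<Inter>(a ` M)" by (auto simp: \<W>_def)
    then have ne: "finite M" "M \<noteq> {}" by (auto simp: \<M>_def)
    have "openin X (a i)" for i using A image_enum_subset by (auto simp: omega_covers_def)
    then show "openin X W" using M(2) ne by (auto intro: openin_Inter)
    obtain i where "i \<in> M" using ne by auto
    then have "W \<subseteq> a i" using M(2) by auto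
    then show "W \<noteq> topspace X" using omega_covers_proper[OF A, of "a i"] range_enum by auto
  next
    fix F assume F: "finite F" "F \<subseteq> topspace X"
    have "{U \<in> a ` N. F \<subseteq> U} = a ` {i \<in> N. F \<subseteq> a i}" by auto
    then have "infinite {i \<in> N. F \<subseteq> a i}"
      using omega_covers_above_infinite[OF N F] by auto
    from infinite_nat_sparse_subset[OF this, of "Suc n" "\<lambda>i. f (f i)"]
    obtain M where "M \<subseteq> {i \<in> N. F \<subseteq> a i}" "finite M" "card M = Suc n"
      "\<forall>i\<in>M. \<forall>j\<in>M. i < j \<longrightarrow> f (f i) \<le> j" by blast
    then have "M \<in> \<M> n" "F \<subseteq> \<Inter>(a ` M)" by (auto simp: \<M>_def)
    then show "\<exists>W\<in>\<W> n. F \<subseteq> W" by (auto simp: \<W>_def)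
  qed
  then obtain W where W: "\<And>n. W n \<in> \<W> n" "range W \<in> omega_covers X"
    using S1 unfolding S1_def by metis
  then have "\<forall>n. \<exists>M. M \<in> \<M> n \<and> W n = \<Inter>(a ` M)" unfolding \<W>_def by blast
  then obtain M where M: "\<And>n. M n \<in> \<M> n" "\<And>n. W n = \<Inter>(a ` M n)" by metis
  define conf where "conf i j \<longleftrightarrow> i \<le> j \<and> j < f i \<or> j \<le> i \<and> i < f j" for i j :: nat
  have conf_unique: "i = j" if "i \<in> M n" "j \<in> M n" "conf p i" "conf p j" for i j p n
  proof -
    \<comment> \<open>Two conflicts with \<open>p\<close> would give \<open>p \<le> f i\<close> and
      \<open>j < f p\<close>, so \<open>j < f (f i)\<close> by monotonicity, against the
      gap.\<close>
    have aux: False if "i \<in> M n" "j \<in> M n" "conf p i" "conf p j" "i < j" for i j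
    proof -
      have gap: "f (f i) \<le> j" using M(1)[of n] that by (auto simp: \<M>_def)
      have "j < f p" using that gap f(2)[of "f i"] f(2)[of i] f(2)[of j]
        by (auto simp: conf_def)
      moreover have "p \<le> f i" using that f(2)[of i] by (auto simp: conf_def)
      ultimately show False using gap monoD[OF f(1), of p "f i"] by auto
    qed
    show ?thesis using aux[of i j] aux[of j i] that by (meson linorder_neqE_nat)
  qed
  have "\<exists>p. \<forall>n. p n \<in> M n \<and> (\<forall>k<n. \<not> conf (p k) (p n))"
  proof (rule dependent_wellorder_choice)
    fix p :: "nat \<Rightarrow> nat" and n
    \<comment> \<open>Sending \<open>k < n\<close> to the only member of \<open>M n\<close> in
      conflict with \<open>p k\<close> covers all excluded members, so at most \<open>n\<close> of
      the \<open>n + 1\<close> are excluded.\<close>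
    have "card {i \<in> M n. \<exists>k<n. conf (p k) i} \<le> card {..<n}"
    proof (rule surj_card_le)
      show "{i \<in> M n. \<exists>k<n. conf (p k) i} \<subseteq> (\<lambda>k. SOME i. i \<in> M n \<and> conf (p k) i) ` {..<n}"
      proof
        fix i assume "i \<in> {i \<in> M n. \<exists>k<n. conf (p k) i}"
        then obtain k where k: "i \<in> M n" "k < n" "conf (p k) i" by auto
        then have "(SOME i. i \<in> M n \<and> conf (p k) i) = i"
          using conf_unique by (intro some_equality) auto
        then show "i \<in> (\<lambda>k. SOME i. i \<in> M n \<and> conf (p k) i) ` {..<n}" using k by force
      qed
    qed simp
    then have "card {i \<in> M n. \<exists>k<n. conf (p k) i} < card (M n)"
      using M(1)[of n] by (auto simp: \<M>_def)
    then have "{i \<in> M n. \<exists>k<n. conf (p k) i} \<noteq> M n" by auto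
    then show "\<exists>i. i \<in> M n \<and> (\<forall>k<n. \<not> conf (p k) i)" by auto
  qed auto
  then obtain p where p: "\<And>n. p n \<in> M n" "\<And>k n. k < n \<Longrightarrow> \<not> conf (p k) (p n)" by blast
  have "range p \<subseteq> N" using p(1) M(1) by (fastforce simp: \<M>_def)
  \<comment> \<open>Each \<open>W n\<close> lies in \<open>a (p n)\<close>, so every finite set
    caught by \<open>range W\<close> stays caught.\<close>
  moreover have "a ` range p \<in> omega_covers X"
    unfolding omega_covers_subset_iff[OF A image_enum_subset]
  proof (intro allI impI)
    fix F assume "finite F \<and> F \<subseteq> topspace X"
    then have "\<exists>U\<in>range W. F \<subseteq> U" using W(2) by (simp add: omega_covers_def)
    then obtain n where "F \<subseteq> W n" by auto
    then have "F \<subseteq> a (p n)" using M(2) p(1) by auto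
    then show "\<exists>U\<in>a ` range p. F \<subseteq> U" by auto
  qed
  moreover have "f i \<le> j" if ij: "i \<in> range p" "j \<in> range p" "i < j" for i j
  proof -
    \<comment> \<open>The order of \<open>i\<close> and \<open>j\<close> need not be the order in
      which they were picked; symmetry of \<open>conf\<close> handles both cases.\<close>
    obtain k n where kn: "i = p k" "j = p n" using ij by auto
    then have "k \<noteq> n" using ij by auto
    then have "\<not> conf i j" using p(2)[of k n] p(2)[of n k] kn
      by (auto simp: conf_def neq_iff)
    then show ?thesis using ij(3) by (auto simp: conf_def)
  qed
  ultimately show ?thesis by blast
qed

text \<open>\<open>S1\<close> picks \<open>c n \<in> C n\<close>, so \<open>c k \<in> C i\<close>
  whenever \<open>i \<le> k\<close>. Let \<open>f i\<close> exceed all \<open>c k\<close> with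
  \<open>k \<le> i\<close>; then on an \<open>f\<close>-sparse subcover \<open>i < j = c k\<close>
  gives \<open>f i \<le> j\<close>, which forces \<open>i < k\<close>.\<close>

lemma diagonal_omega_cover:
  assumes C: "\<And>n. a ` C n \<in> omega_covers X" "decseq C"
  shows "\<exists>D. a ` D \<in> omega_covers X \<and> D \<subseteq> C 0 \<and> (\<forall>i\<in>D. \<forall>j\<in>D. i < j \<longrightarrow> j \<in> C i)"
proof -
  have "\<exists>U. (\<forall>n. U n \<in> a ` C n) \<and> range U \<in> omega_covers X"
    using S1 C(1) unfolding S1_def by (auto dest: spec[of _ "\<lambda>n. a ` C n"])
  then obtain U where U: "\<And>n. U n \<in> a ` C n" "range U \<in> omega_covers X" by blast
  then have "\<forall>n. \<exists>i. i \<in> C n \<and> U n = a i" by blast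
  then obtain c where c: "\<And>n. c n \<in> C n" "\<And>n. U n = a (c n)" by metis
  have cov: "a ` range c \<in> omega_covers X" using U(2) c(2) by (simp add: image_image)
  \<comment> \<open>The sum dominates every \<open>c k\<close> with \<open>k \<le> n\<close> and is
    monotone in \<open>n\<close>; \<open>Suc\<close> makes the bounds strict.\<close>
  define f where "f n = Suc (n + (\<Sum>k\<le>n. c k))" for n
  have "mono f"
    unfolding f_def mono_def by (auto intro!: add_mono sum_mono2)
  moreover have "n < f n" for n by (simp add: f_def)
  ultimately obtain D where D: "D \<subseteq> range c" "a ` D \<in> omega_covers X"
    "\<forall>i\<in>D. \<forall>j\<in>D. i < j \<longrightarrow> f i \<le> j"
    using sparse_omega_cover[OF cov] by blast
  have mono: "c k \<in> C n" if "n \<le> k" for n k using c(1)[of k] decseqD[OF C(2) that] by auto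
  have "j \<in> C i" if ij: "i \<in> D" "j \<in> D" "i < j" for i j
  proof -
    obtain k where k: "j = c k" using D(1) ij(2) by auto
    have "i < k"
    proof (rule ccontr)
      assume "\<not> i < k"
      then have "c k \<le> (\<Sum>k\<le>i. c k)" by (intro member_le_sum) auto
      then have "j < f i" using k by (simp add: f_def)
      then show False using D(3) ij by (meson leD)
    qed
    then show ?thesis using mono k by simp
  qed
  moreover have "D \<subseteq> C 0" using D(1) mono[of 0] by auto
  ultimately show ?thesis using D(2) by blast
qed

lemma selective_coideal_omega_covers: "selective_coideal {N. a ` N \<in> omega_covers X}"
proof
  fix N assume "N \<in> {N. a ` N \<in> omega_covers X}"
  then show "infinite N" using omega_covers_infinite[of "a ` N" X] by auto
next
  fix N M assume "N \<in> {N. a ` N \<in> omega_covers X}" "N \<subseteq> M"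
  then show "M \<in> {N. a ` N \<in> omega_covers X}"
    using omega_covers_mono[OF A, of "a ` N" "a ` M"] image_enum_subset by auto
next
  fix N M assume "N \<union> M \<in> {N. a ` N \<in> omega_covers X}"
  then show "N \<in> {N. a ` N \<in> omega_covers X} \<or> M \<in> {N. a ` N \<in> omega_covers X}"
    using omega_covers_Un by (auto simp: image_Un)
next
  fix C :: "nat \<Rightarrow> nat set"
  assume "\<And>n. C n \<in> {N. a ` N \<in> omega_covers X}" "decseq C"
  then show "\<exists>D\<in>{N. a ` N \<in> omega_covers X}. D \<subseteq> C 0 \<and> (\<forall>i\<in>D. \<forall>j\<in>D. i < j \<longrightarrow> j \<in> C i)"
    using diagonal_omega_cover[of C] by auto
qed

section \<open>Transfer between Ellentuck neighbourhoods and index sets\<close>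

lemma image_enum_ctbl_inf: "a ` N \<in> omega_covers X \<Longrightarrow> a ` N \<in> ctbl_inf_subsets A"
  using omega_covers_infinite[of "a ` N" X] image_enum_subset[of N]
  by (simp add: ctbl_inf_subsets_def)

text \<open>Take a basic neighbourhood \<open>[s,C]\<close> of the image of \<open>E\<close> and let
  \<open>k\<close> exceed all indices of \<open>s\<close>. Removing indices of \<open>E\<close> from
  \<open>k\<close> on keeps \<open>s\<close>, and what remains outside \<open>s\<close> lies in
  \<open>C\<close>; it is infinite because \<open>s\<close> is finite.\<close>

lemma ellentuck_open_local:
  assumes R: "openin (subtopology (ellentuck_topology A a) (ctbl_inf_subsets A \<inter> omega_covers X)) R"
    and E: "a ` E \<in> R"
  shows "\<exists>k. \<forall>E'. a ` E' \<in> omega_covers X \<and> E' \<subseteq> E \<and> E' \<inter> {..<k} = E \<inter> {..<k} \<longrightarrow> a ` E' \<in> R"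
proof -
  obtain V where V: "openin (ellentuck_topology A a) V"
    "R = V \<inter> (ctbl_inf_subsets A \<inter> omega_covers X)"
    using R by (auto simp: openin_subtopology)
  obtain s C where s: "finite s" "s \<subseteq> A" "a ` E \<in> ellentuck_set A s C" "ellentuck_set A s C \<subseteq> V"
    using V E openin_ellentuck_topology[OF a, of V] unfolding ellentuck_base_def by blast
  obtain D where D: "a ` E = s \<union> D" "D \<subseteq> C"
    using s(3) by (auto simp: ellentuck_set_def)
  have "finite (a -` s)" using s(1) inj_enum by (simp add: finite_vimageI)
  then obtain k where k: "\<And>i. a i \<in> s \<Longrightarrow> i < k"
    using finite_nat_bounded[of "a -` s"] by auto
  have "a ` E' \<in> R" if E': "a ` E' \<in> omega_covers X" "E' \<subseteq> E" "E' \<inter> {..<k} = E \<inter> {..<k}" for E'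
  proof -
    have "s \<subseteq> a ` E'"
    proof
      fix U assume "U \<in> s"
      then obtain i where "i \<in> E" "U = a i" using D(1) by blast
      then show "U \<in> a ` E'" using k[of i] \<open>U \<in> s\<close> E'(3) by auto
    qed
    then have "a ` E' = s \<union> (a ` E' - s)" by auto
    moreover have "a ` E' - s \<subseteq> C" using D E'(2) by blast
    moreover have "a ` E' - s \<in> ctbl_inf_subsets A"
      using image_enum_ctbl_inf[OF E'(1)] s(1) by (auto simp: ctbl_inf_subsets_def)
    ultimately have "a ` E' \<in> ellentuck_set A s C" unfolding ellentuck_set_def by blast
    then show ?thesis using s(4) V(2) E'(1) image_enum_ctbl_inf by auto
  qed
  then show ?thesis by blast
qed

lemma ellentuck_open_completely_ramsey:
  assumes R: "openin (subtopology (ellentuck_topology A a) (ctbl_inf_subsets A \<inter> omega_covers X)) R"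
  shows "completely_ramsey X A a R"
  unfolding completely_ramsey_def
proof (intro conjI allI impI)
  show "R \<subseteq> ctbl_inf_subsets A \<inter> omega_covers X" using openin_subset[OF R] by auto
next
  fix s B
  assume sB: "finite s \<and> s \<subseteq> A \<and> B \<in> ctbl_inf_subsets (tail_after a A s) \<inter> omega_covers X"
  define s' where "s' = a -` s"
  define B' where "B' = a -` B"
  have B_sub: "B \<subseteq> tail_after a A s" using sB by (auto simp: ctbl_inf_subsets_def)
  then have "B \<subseteq> A" by (auto simp: tail_after_def)
  then have im: "s = a ` s'" "B = a ` B'"
    using sB range_enum by (auto simp: s'_def B'_def)
  have lt: "\<forall>x\<in>s'. \<forall>y\<in>B'. x < y"
    using B_sub unfolding s'_def B'_def tail_after_def set_before_def by blast
  have fin: "finite s'" unfolding s'_def using sB inj_enum by (simp add: finite_vimageI)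
  interpret selective_coideal "{N. a ` N \<in> omega_covers X}" by (rule selective_coideal_omega_covers)
  have "\<exists>C\<in>{N. a ` N \<in> omega_covers X}. C \<subseteq> B' \<and>
    ((\<forall>D\<in>{N. a ` N \<in> omega_covers X}. D \<subseteq> C \<longrightarrow> s' \<union> D \<in> {N. a ` N \<in> R}) \<or>
     (\<forall>D\<in>{N. a ` N \<in> omega_covers X}. D \<subseteq> C \<longrightarrow> s' \<union> D \<notin> {N. a ` N \<in> R}))"
  proof (rule open_imp_ramsey)
    fix E assume "E \<in> {N. a ` N \<in> R}"
    then show "\<exists>k. \<forall>E'\<in>{N. a ` N \<in> omega_covers X}.
        E' \<subseteq> E \<and> E' \<inter> {..<k} = E \<inter> {..<k} \<longrightarrow> E' \<in> {N. a ` N \<in> R}"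
      using ellentuck_open_local[OF R, of E] by blast
  qed (use sB im fin lt in auto)
  then obtain C where C: "a ` C \<in> omega_covers X" "C \<subseteq> B'"
    and alt: "(\<forall>D. a ` D \<in> omega_covers X \<and> D \<subseteq> C \<longrightarrow> a ` (s' \<union> D) \<in> R) \<or>
      (\<forall>D. a ` D \<in> omega_covers X \<and> D \<subseteq> C \<longrightarrow> a ` (s' \<union> D) \<notin> R)"
    by blast
  \<comment> \<open>An Ellentuck set allows any infinite \<open>D\<close>, but if
    \<open>s \<union> D\<close> is an \<omega>-cover, then so is \<open>D\<close>, since the finite
    \<open>s\<close> cannot be one. Hence the dichotomy over the coideal suffices.\<close>
  have elem: "\<exists>D. a ` D \<in> omega_covers X \<and> D \<subseteq> C \<and> E = a ` (s' \<union> D)"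
    if "E \<in> ellentuck_set A s (a ` C) \<inter> omega_covers X" for E
  proof -
    obtain D where D: "E = s \<union> D" "D \<subseteq> a ` C" using \<open>E \<in> _\<close> by (auto simp: ellentuck_set_def)
    then obtain D' where D': "D' \<subseteq> C" "D = a ` D'" by (meson subset_imageE)
    have "D \<in> omega_covers X"
      using that D(1) omega_covers_Un[of s D X] omega_covers_infinite[of s X] sB by auto
    then show ?thesis using D D' im by (auto simp: image_Un)
  qed
  show "\<exists>C\<in>ctbl_inf_subsets B \<inter> omega_covers X.
      ellentuck_set A s C \<inter> omega_covers X \<subseteq> R \<or> ellentuck_set A s C \<inter> omega_covers X \<inter> R = {}"
  proof (rule bexI[of _ "a ` C"])
    show "a ` C \<in> ctbl_inf_subsets B \<inter> omega_covers X"
      using C image_enum_ctbl_inf[OF C(1)] im by (auto simp: ctbl_inf_subsets_def)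
    show "ellentuck_set A s (a ` C) \<inter> omega_covers X \<subseteq> R \<or>
        ellentuck_set A s (a ` C) \<inter> omega_covers X \<inter> R = {}"
      using alt elem by blast
  qed
qed

end

theorem theorem5:
  fixes X :: "'a topology" and A :: "'a set set" and a :: "nat \<Rightarrow> 'a set"
    and R :: "'a set set set"
  assumes "S1 (omega_covers X) (omega_covers X)"
    and "A \<in> omega_covers X"
    and "countable A"
    and "bij_betw a UNIV A"
    and "openin (subtopology (ellentuck_topology A a)
                   (ctbl_inf_subsets A \<inter> omega_covers X)) R"
  shows "completely_ramsey X A a R"
  using assms(1,2,4,5) by (rule ellentuck_open_completely_ramsey)

end
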